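(* Consider the Engel group modelled on $\mathbb R^4$ as in the context. Let $E\subseteq\mathbb R^4$ be an $X_2$-calibrated set, let $a\in\mathbb R$ with $a\neq0$, put $Y=aX_1+X_2$ and $W=\{p\in\mathbb R^4:p_2=0\}$. If $E$ is represented as intrinsic upper graph in the direction $Y$, i.e. $$E=\{w\cdot\exp(tY):w\in W,\ t>T(w)\}$$ for a function $T:W\to\mathbb R$, then $T$ is intrinsically Lipschitz-continuous.
   Context: The Engel group is $\mathbb R^4$ with product $$p\cdot q=\left(p_1+q_1,\;p_2+q_2,\;p_3+q_3+p_1q_2,\;p_4+q_4+p_1q_3+\tfrac{p_1^2}{2}q_2\right),$$ for which $X_1=\partial_1$, $X_2=\partial_2+x_1\partial_3+\frac{x_1^2}{2}\partial_4$, $X_3=\partial_3+x_1\partial_4$, $X_4=\partial_4$ are left-invariant. The horizontal layer is $V_1=\mathrm{span}\{X_1,X_2\}$. The flow of $Y=aX_1+X_2$ is $$p\cdot\exp(tY)=\left(p_1+at,\;p_2+t,\;p_3+p_1t+\tfrac a2t^2,\;p_4+\tfrac{p_1^2}{2}t+\tfrac{ap_1}{2}t^2+\tfrac{a^2}{6}t^3\right).$$ $W$ is a subgroup, and every $q\in\mathbb R^4$ can be written uniquely as $q=w\cdot\exp(tY)$ with $w\in W$, $t\in\mathbb R$. An open set $E\subseteq\mathbb R^4$ is $X_2$-calibrated if: (i) $p\in E$ implies $p+(t,0,0,0)\in E$ for every $t\in\mathbb R$; (ii) for all $p\in\mathbb R^4$ there is $T\in[-\infty,+\infty]$ with $\{t\in\mathbb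 R:p+(0,t,p_1t,p_1^2t/2)\in E\}=(T,+\infty)$. Let $d$ be the Carnot-Carathéodory distance on the Engel group associated with a scalar product on $V_1$ and $\|q\|=d(0,q)$. A function $T:W\to\mathbb R$ is intrinsically Lipschitz-continuous (in direction $Y$) if its graph avoids intrinsic cones of fixed aperture centred at its own points: there is $L\ge0$ such that for all $q,q'$ in the graph $\{w\exp(T(w)Y):w\in W\}$, writing $q^{-1}\cdot q'=w\cdot\exp(sY)$ with $w\in W$, $s\in\mathbb R$, one has $|s|\le L\|w\|$. (The choice of scalar product only affects $L$.) *)

theory Defs
  imports "HOL-Analysis.Analysis"
begin

lemma vector_4 [simp]:
  "(vector [w, x, y, z] :: ('a::zero)^4) $ 1 = w"
  "(vector [w, x, y, z] :: ('a::zero)^4) $ 2 = x"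
  "(vector [w, x, y, z] :: ('a::zero)^4) $ 3 = y"
  "(vector [w, x, y, z] :: ('a::zero)^4) $ 4 = z"
  unfolding vector_def by simp_all

definition engel_mult :: "real^4 \<Rightarrow> real^4 \<Rightarrow> real^4"  (infixl "\<odot>" 70) where
  "p \<odot> q = vector [p$1 + q$1,
                   p$2 + q$2,
                   p$3 + q$3 + p$1 * q$2,
                   p$4 + q$4 + p$1 * q$3 + (p$1)\<^sup>2 / 2 * q$2]"

definition engel_inv :: "real^4 \<Rightarrow> real^4" where
  "engel_inv p = vector [- p$1,
                         - p$2,
                         - p$3 + p$1 * p$2,
                         - p$4 + p$1 * p$3 - (p$1)\<^sup>2 / 2 * p$2]"

lemma engel_group: "group engel_mult 0 engel_inv"
proof unfold_locales
  show "(p \<odot> q) \<odot> r = p \<odot> (q \<odot> r)" for p q r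
    unfolding vec_eq_iff forall_4 engel_mult_def vector_4
    by (intro conjI; algebra)
  show "0 \<odot> p = p" for p
    by (simp add: engel_mult_def vec_eq_iff forall_4)
  show "engel_inv p \<odot> p = 0" for p
    by (simp add: engel_mult_def engel_inv_def vec_eq_iff forall_4)
qed

definition X1 :: "real^4 \<Rightarrow> real^4" where
  "X1 p = vector [1, 0, 0, 0]"

definition X2 :: "real^4 \<Rightarrow> real^4" where
  "X2 p = vector [0, 1, p$1, (p$1)\<^sup>2 / 2]"

(* exp(tY) for Y = a X1 + X2: the time-t point of the integral curve of Y through the identity *)
definition expY :: "real \<Rightarrow> real \<Rightarrow> real^4" where
  "expY a t = vector [a * t, t, a / 2 * t ^ 2, a\<^sup>2 / 6 * t ^ 3]"

lemma mult_expY: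
  "p \<odot> expY a t = vector [p$1 + a * t,
                         p$2 + t,
                         p$3 + p$1 * t + a / 2 * t ^ 2,
                         p$4 + (p$1)\<^sup>2 / 2 * t + a * p$1 / 2 * t ^ 2 + a\<^sup>2 / 6 * t ^ 3]"
  by (simp add: engel_mult_def expY_def vec_eq_iff forall_4)

lemma mult_expY_flow:
  "((\<lambda>t. p \<odot> expY a t) has_vector_derivative
     (a *\<^sub>R X1 (p \<odot> expY a t) + X2 (p \<odot> expY a t))) (at t)"
proof -
  have c2: "((\<lambda>t. c * t ^ 2) has_real_derivative c * (2 * t)) (at t)" for c
    by (auto intro!: derivative_eq_intros)
  have c3: "((\<lambda>t. c * t ^ 3) has_real_derivative c * (3 * t\<^sup>2)) (at t)" for c
    by (auto intro!: derivative_eq_intros)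
  have 1: "((\<lambda>t. p$1 + a * t) has_real_derivative a) (at t)"
    by (auto intro!: derivative_eq_intros)
  have 2: "((\<lambda>t. p$2 + t) has_real_derivative 1) (at t)"
    by (auto intro!: derivative_eq_intros)
  have 3: "((\<lambda>t. p$3 + p$1 * t + a / 2 * t ^ 2) has_real_derivative p$1 + a * t) (at t)"
    by (rule DERIV_cong[OF DERIV_add[OF DERIV_add[OF DERIV_const DERIV_cmult_Id] c2]]) simp
  have 4: "((\<lambda>t. p$4 + (p$1)\<^sup>2 / 2 * t + a * p$1 / 2 * t ^ 2 + a\<^sup>2 / 6 * t ^ 3)
      has_real_derivative (p$1 + a * t)\<^sup>2 / 2) (at t)"
    by (rule DERIV_cong[OF DERIV_add[OF DERIV_add[OF DERIV_add[OF DERIV_const DERIV_cmult_Id] c2] c3]])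
      (simp add: power2_eq_square algebra_simps add_divide_distrib)
  have "\<forall>i. ((\<lambda>t. (p \<odot> expY a t) $ i) has_real_derivative
      (a *\<^sub>R X1 (p \<odot> expY a t) + X2 (p \<odot> expY a t)) $ i) (at t)"
    unfolding forall_4 mult_expY X1_def X2_def vector_4 vector_add_component vector_scaleR_component
    using 1 2 3 4 by simp
  then have D: "((\<lambda>t. (p \<odot> expY a t) $ i) has_derivative
      (\<lambda>x. x * (a *\<^sub>R X1 (p \<odot> expY a t) + X2 (p \<odot> expY a t)) $ i)) (at t)" for i
    unfolding has_field_derivative_def by (subst mult.commute) (rule spec)
  show ?thesis
    unfolding has_vector_derivative_def
  proof (rule has_derivative_componentwise_within[THEN iffD2], rule ballI)
    fix b :: "real^4" assume "b \<in> Basis"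
    then obtain i where b: "b = axis i 1" by (auto simp: Basis_vec_def)
    show "((\<lambda>t. (p \<odot> expY a t) \<bullet> b) has_derivative
        (\<lambda>x. (x *\<^sub>R (a *\<^sub>R X1 (p \<odot> expY a t) + X2 (p \<odot> expY a t))) \<bullet> b)) (at t)"
      unfolding b inner_axis inner_real_def vector_scaleR_component real_scaleR_def mult_1_right
      by (rule D)
  qed
qed

definition W :: "(real^4) set" where
  "W = {p. p$2 = 0}"

lemma ex1_decomposition: "\<exists>!(w, t). w \<in> W \<and> q = w \<odot> expY a t"
proof (rule ex1I)
  interpret group engel_mult 0 engel_inv by (rule engel_group)
  have "(q \<odot> engel_inv (expY a (q$2))) $ 2 = 0"
    by (simp add: engel_mult_def engel_inv_def expY_def)
  then show "case (q \<odot> engel_inv (expY a (q$2)), q$2) of (w, t) \<Rightarrow> w \<in> W \<and> q = w \<odot> expY a t"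
    by (simp add: W_def assoc)
  fix x assume x: "case x of (w, t) \<Rightarrow> w \<in> W \<and> q = w \<odot> expY a t"
  then obtain w t where wt: "x = (w, t)" "w \<in> W" "q = w \<odot> expY a t" by (cases x) auto
  have t: "q$2 = t" using wt(2) by (simp add: wt(3) W_def mult_expY)
  have w: "q \<odot> engel_inv (expY a t) = w" by (simp add: wt(3) assoc)
  show "x = (q \<odot> engel_inv (expY a (q$2)), q$2)" by (simp only: wt(1) t w)
qed

definition X2_calibrated :: "(real^4) set \<Rightarrow> bool" where
  "X2_calibrated E \<longleftrightarrow>
     open E \<and>
     (\<forall>p\<in>E. \<forall>t. p + vector [t, 0, 0, 0] \<in> E) \<and>
     (\<forall>p. \<exists>T::ereal.
        {t::real. p + vector [0, t, p$1 * t, (p$1)\<^sup>2 * t / 2] \<in> E} = {t. T < ereal t})"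

(* The horizontal layer V1 = span {X1, X2} is identified with real^2 through the basis (X1, X2);
   a scalar product on V1 is thus a bilinear form B on real^2. *)
definition scalar_product_on_V1 :: "(real^2 \<Rightarrow> real^2 \<Rightarrow> real) \<Rightarrow> bool" where
  "scalar_product_on_V1 B \<longleftrightarrow>
     bilinear B \<and> (\<forall>u v. B u v = B v u) \<and> (\<forall>u. u \<noteq> 0 \<longrightarrow> 0 < B u u)"

(* \<gamma> : [0,1] \<rightarrow> R^4 is absolutely continuous with \<gamma>'(t) = h_1(t) X1(\<gamma>(t)) + h_2(t) X2(\<gamma>(t))
   for a.e. t, h in L^1: Caratheodory's integral form of that differential equation. *)
definition horizontal_curve :: "(real \<Rightarrow> real^2) \<Rightarrow> (real \<Rightarrow> real^4) \<Rightarrow> bool" where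
  "horizontal_curve h \<gamma> \<longleftrightarrow>
     h absolutely_integrable_on {0..1} \<and>
     (\<forall>t\<in>{0..1}. ((\<lambda>s. h s $ 1 *\<^sub>R X1 (\<gamma> s) + h s $ 2 *\<^sub>R X2 (\<gamma> s))
                      has_integral (\<gamma> t - \<gamma> 0)) {0..t})"

definition curve_length :: "(real^2 \<Rightarrow> real^2 \<Rightarrow> real) \<Rightarrow> (real \<Rightarrow> real^2) \<Rightarrow> real" where
  "curve_length B h = integral {0..1} (\<lambda>t. sqrt (B (h t) (h t)))"

(* The set of lengths is never empty: any two points are joined by a horizontal curve (Chow). *)
definition cc_dist :: "(real^2 \<Rightarrow> real^2 \<Rightarrow> real) \<Rightarrow> real^4 \<Rightarrow> real^4 \<Rightarrow> real" where
  "cc_dist B p q =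
     Inf {curve_length B h | h \<gamma>. horizontal_curve h \<gamma> \<and> \<gamma> 0 = p \<and> \<gamma> 1 = q}"

definition cc_norm :: "(real^2 \<Rightarrow> real^2 \<Rightarrow> real) \<Rightarrow> real^4 \<Rightarrow> real" where
  "cc_norm B q = cc_dist B 0 q"

definition intrinsic_graph :: "real \<Rightarrow> (real^4 \<Rightarrow> real) \<Rightarrow> (real^4) set" where
  "intrinsic_graph a T = {w \<odot> expY a (T w) | w. w \<in> W}"

definition intrinsic_upper_graph :: "real \<Rightarrow> (real^4 \<Rightarrow> real) \<Rightarrow> (real^4) set" where
  "intrinsic_upper_graph a T = {w \<odot> expY a t | w t. w \<in> W \<and> T w < t}"

definition intrinsic_Lipschitz ::
  "(real^2 \<Rightarrow> real^2 \<Rightarrow> real) \<Rightarrow> real \<Rightarrow> (real^4 \<Rightarrow> real) \<Rightarrow> bool" where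
  "intrinsic_Lipschitz B a T \<longleftrightarrow>
     (\<exists>L\<ge>0. \<forall>q \<in> intrinsic_graph a T. \<forall>q' \<in> intrinsic_graph a T.
        \<forall>w\<in>W. \<forall>s. engel_inv q \<odot> q' = w \<odot> expY a s \<longrightarrow> \<bar>s\<bar> \<le> L * cc_norm B w)"

end

theory Submission
  imports Defs
begin

text \<open>
  A calibrated set is stable under the flow of \<open>X1\<close> in both directions and under the forward flow of
  \<open>X2\<close>, hence under right multiplication by every \<open>x\<close> with \<open>x\<^sub>2 > 0\<close> and \<open>2 x\<^sub>2 x\<^sub>4 > x\<^sub>3\<^sup>2\<close>.
  This open, dilation-invariant cone contains \<open>exp (tY)\<close> for \<open>t > 0\<close> because \<open>a \<noteq> 0\<close>, so it
  contains \<open>w \<cdot> exp (sY)\<close> and, for negative \<open>s\<close>, its inverse as soon as the homogeneous norm of \<open>w\<close> is small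
  compared with \<open>|s|\<close>. Two points of the graph cannot differ by an element of the cone,
  since the second one would then lie in \<open>E\<close>.
\<close>

section \<open>Lower bounds for the length of horizontal curves\<close>

text \<open>The norm of \<open>B\<close> is continuous, so it attains its extrema on the unit
  sphere, and homogeneity extends the bounds to all vectors. Continuity is exported because
  measurability of the speed of a curve rests on it.\<close>

lemma scalar_product_bounds:
  assumes "scalar_product_on_V1 B"
  obtains c C where "0 < c" "\<And>u. c * norm u \<le> sqrt (B u u)" "\<And>u. sqrt (B u u) \<le> C * norm u"
    "continuous_on UNIV (\<lambda>u. sqrt (B u u))"
proof -
  have bil: "bilinear B" and pos: "\<And>u. u \<noteq> 0 \<Longrightarrow> 0 < B u u"
    using assms by (auto simp: scalar_product_on_V1_def)
  interpret B: bounded_bilinear B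
    using bil by (simp add: bilinear_conv_bounded_bilinear)
  have cont: "continuous_on A (\<lambda>u. sqrt (B u u))" for A
    by (intro continuous_intros B.continuous_on)
  have hom: "sqrt (B u u) = norm u * sqrt (B (sgn u) (sgn u))" for u
    by (cases "u = 0")
      (auto simp: sgn_div_norm B.scaleR_left B.scaleR_right B.zero_left real_sqrt_mult real_sqrt_divide)
  have compact: "compact (sphere 0 1 :: (real^2) set)" by simp
  have ne: "sphere 0 1 \<noteq> ({} :: (real^2) set)" by simp
  obtain v where v: "v \<in> sphere 0 1" "\<And>u. u \<in> sphere 0 1 \<Longrightarrow> sqrt (B v v) \<le> sqrt (B u u)"
    using continuous_attains_inf[OF compact ne cont] by blast
  obtain v' where v': "\<And>u. u \<in> sphere 0 1 \<Longrightarrow> sqrt (B u u) \<le> sqrt (B v' v')"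
    using continuous_attains_sup[OF compact ne cont] by blast
  have sgn_sphere: "sgn u \<in> sphere 0 1" if "u \<noteq> 0" for u :: "real^2"
    using that by (simp add: norm_sgn)
  show thesis
  proof
    show "0 < sqrt (B v v)" using v(1) pos[of v] by fastforce
    show "sqrt (B v v) * norm u \<le> sqrt (B u u)" for u
      using v(2)[OF sgn_sphere, of u] hom[of u]
      by (cases "u = 0") (auto simp: B.zero_left mult.commute mult_left_mono)
    show "sqrt (B u u) \<le> sqrt (B v' v') * norm u" for u
      using v'[OF sgn_sphere, of u] hom[of u]
      by (cases "u = 0") (auto simp: B.zero_left mult.commute mult_left_mono)
  qed (rule cont)
qed

text \<open>Integrating the lower bound requires the speed to be integrable: \<open>integral\<close>
  has a default value otherwise. The upper bound with \<open>C\<close> and continuity supply this,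
  by domination and measurability.\<close>

lemma norm_integral_le_curve_length:
  assumes c: "0 \<le> c" "\<And>u. c * norm u \<le> sqrt (B u u)" and C: "\<And>u. sqrt (B u u) \<le> C * norm u"
    and cont: "continuous_on UNIV (\<lambda>u. sqrt (B u u))"
    and h: "h absolutely_integrable_on {0..1}"
  shows "c * integral {0..1} (\<lambda>t. norm (h t)) \<le> curve_length B h"
proof -
  have n: "(\<lambda>t. norm (h t)) integrable_on {0..1}"
    using h by (simp add: absolutely_integrable_on_def)
  have "(\<lambda>t. sqrt (B (h t) (h t))) integrable_on {0..1}"
  proof (rule measurable_bounded_by_integrable_imp_integrable)
    have "h \<in> borel_measurable (lebesgue_on {0..1})"
      using absolutely_integrable_measurable[of "{0..1::real}" h] h by simp
    from measurable_compose[OF this borel_measurable_continuous_onI[OF cont]]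
    show "(\<lambda>t. sqrt (B (h t) (h t))) \<in> borel_measurable (lebesgue_on {0..1})" .
    show "(\<lambda>t. C * norm (h t)) integrable_on {0..1}"
      using n by (rule integrable_on_mult_right)
    \<comment> \<open>\<open>sqrt\<close> is negative at negative arguments in HOL, so the sign is
      read off the lower bound.\<close>
    have "0 \<le> sqrt (B u u)" for u
      using c(2)[of u] c(1) by (meson order.trans mult_nonneg_nonneg norm_ge_zero)
    then show "norm (sqrt (B (h t) (h t))) \<le> C * norm (h t)" for t
      using C[of "h t"] by simp
  qed auto
  then show ?thesis
    unfolding curve_length_def integral_mult_right[symmetric]
    by (intro integral_le integrable_on_mult_right n) (use c(2) in auto)
qed

text \<open>The exponents are the weights of the coordinates under the dilations. The first
  coordinate stays below \<open>M\<close> along the whole curve; inserting this into the integrands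
  of the third and fourth coordinates contributes one or two more factors \<open>M\<close>.\<close>

lemma horizontal_curve_endpoint_bounds:
  assumes hc: "horizontal_curve h \<gamma>" and "\<gamma> 0 = 0"
  defines "M \<equiv> integral {0..1} (\<lambda>t. norm (h t))"
  shows "\<bar>\<gamma> 1 $ 1\<bar> \<le> M" "\<bar>\<gamma> 1 $ 3\<bar> \<le> M ^ 2" "\<bar>\<gamma> 1 $ 4\<bar> \<le> M ^ 3"
proof -
  have n: "(\<lambda>t. norm (h t)) integrable_on {0..1}"
    using hc by (simp add: horizontal_curve_def absolutely_integrable_on_def)
  have M0: "0 \<le> M" unfolding M_def by (intro integral_nonneg n) auto
  have comp: "((\<lambda>s. (h s $ 1 *\<^sub>R X1 (\<gamma> s) + h s $ 2 *\<^sub>R X2 (\<gamma> s)) $ i) has_integral \<gamma> t $ i) {0..t}"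
    if "t \<in> {0..1}" for t i
  proof -
    have "((\<lambda>s. h s $ 1 *\<^sub>R X1 (\<gamma> s) + h s $ 2 *\<^sub>R X2 (\<gamma> s)) has_integral \<gamma> t) {0..t}"
      using hc that assms(2) by (simp add: horizontal_curve_def)
    from has_integral_linear[OF this bounded_linear_vec_nth[of i]] show ?thesis
      by (simp only: o_def)
  qed
  have i1: "((\<lambda>s. h s $ 1) has_integral \<gamma> t $ 1) {0..t}" if "t \<in> {0..1}" for t
    using comp[OF that, of 1] by (simp add: X1_def X2_def)
  have i3: "((\<lambda>s. h s $ 2 * \<gamma> s $ 1) has_integral \<gamma> 1 $ 3) {0..1}"
    using comp[of 1 3] by (simp add: X1_def X2_def)
  have i4: "((\<lambda>s. h s $ 2 * ((\<gamma> s $ 1)\<^sup>2 / 2)) has_integral \<gamma> 1 $ 4) {0..1}"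
    using comp[of 1 4] by (simp add: X1_def X2_def)
  have b1: "\<bar>\<gamma> t $ 1\<bar> \<le> M" if t: "t \<in> {0..1}" for t
  proof -
    have sub: "{0..t} \<subseteq> {0..1}" using t by auto
    have nt: "(\<lambda>t. norm (h t)) integrable_on {0..t}"
      using integrable_on_subinterval[OF n sub] .
    have "norm (integral {0..t} (\<lambda>s. h s $ 1)) \<le> integral {0..t} (\<lambda>s. norm (h s))"
      using i1[OF t] by (intro integral_norm_bound_integral nt)
        (auto simp: has_integral_integrable component_le_norm_cart)
    also have "\<dots> \<le> M"
      unfolding M_def by (intro integral_subset_le sub nt n) auto
    finally show ?thesis using integral_unique[OF i1[OF t]] by simp
  qed
  have scaled: "\<bar>x\<bar> \<le> K * M"
    if "(f has_integral x) {0..1}" "\<And>t. t \<in> {0..1} \<Longrightarrow> \<bar>f t\<bar> \<le> K * norm (h t)" for f :: "real \<Rightarrow> real" and x K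
  proof -
    have "norm (integral {0..1} f) \<le> integral {0..1} (\<lambda>t. K * norm (h t))"
      using that by (intro integral_norm_bound_integral integrable_on_mult_right n)
        (auto simp: has_integral_integrable)
    then show ?thesis using integral_unique[OF that(1)] by (simp add: M_def)
  qed
  have h2: "\<bar>h t $ 2\<bar> \<le> norm (h t)" for t by (rule component_le_norm_cart)
  show "\<bar>\<gamma> 1 $ 1\<bar> \<le> M" by (rule b1) simp
  have "\<bar>\<gamma> 1 $ 3\<bar> \<le> M * M"
  proof (rule scaled[OF i3])
    show "\<bar>h t $ 2 * \<gamma> t $ 1\<bar> \<le> M * norm (h t)" if "t \<in> {0..1}" for t
      using mult_mono[OF b1[OF that] h2[of t]] M0 by (simp add: abs_mult mult.commute)
  qed
  then show "\<bar>\<gamma> 1 $ 3\<bar> \<le> M ^ 2" by (simp add: power2_eq_square)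
  have "\<bar>\<gamma> 1 $ 4\<bar> \<le> M\<^sup>2 * M"
  proof (rule scaled[OF i4])
    show "\<bar>h t $ 2 * ((\<gamma> t $ 1)\<^sup>2 / 2)\<bar> \<le> M\<^sup>2 * norm (h t)" if "t \<in> {0..1}" for t
    proof -
      have "(\<gamma> t $ 1)\<^sup>2 \<le> M\<^sup>2" using b1[OF that] M0 by (simp add: abs_le_square_iff[symmetric])
      then have "(\<gamma> t $ 1)\<^sup>2 / 2 \<le> M\<^sup>2" by (smt (verit) field_sum_of_halves zero_le_power2)
      from mult_mono[OF this h2[of t]] show ?thesis by (simp add: abs_mult mult.commute)
    qed
  qed
  then show "\<bar>\<gamma> 1 $ 4\<bar> \<le> M ^ 3" by (simp add: power3_eq_cube power2_eq_square)
qed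

section \<open>Horizontal curves from the identity to points of \<open>W\<close>\<close>

text \<open>For a continuously differentiable curve the integral form of the equation is the
  fundamental theorem of calculus, checked coordinate by coordinate.\<close>

lemma horizontal_curveI:
  fixes f1 f2 f3 f4 h1 h2 :: "real \<Rightarrow> real"
  assumes "\<And>t. (f1 has_real_derivative h1 t) (at t)"
    and "\<And>t. (f2 has_real_derivative h2 t) (at t)"
    and "\<And>t. (f3 has_real_derivative h2 t * f1 t) (at t)"
    and "\<And>t. (f4 has_real_derivative h2 t * ((f1 t)\<^sup>2 / 2)) (at t)"
    and "continuous_on UNIV h1" "continuous_on UNIV h2"
  shows "horizontal_curve (\<lambda>t. vector [h1 t, h2 t]) (\<lambda>t. vector [f1 t, f2 t, f3 t, f4 t])"
    (is "horizontal_curve ?h ?\<gamma>")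
proof -
  have "continuous_on {0..1} (\<lambda>t. \<chi> i. ?h t $ i)"
  proof (rule continuous_on_vec_lambda)
    show "continuous_on {0..1} (\<lambda>t. ?h t $ i)" for i :: 2
      using exhaust_2[of i] assms(5,6) by (auto intro: continuous_on_subset)
  qed
  then have "?h absolutely_integrable_on {0..1}"
    by (intro absolutely_integrable_continuous_real) simp
  moreover have "((\<lambda>s. ?h s $ 1 *\<^sub>R X1 (?\<gamma> s) + ?h s $ 2 *\<^sub>R X2 (?\<gamma> s)) has_integral ?\<gamma> t - ?\<gamma> 0) {0..t}"
    if "t \<in> {0..1}" for t
  proof (rule fundamental_theorem_of_calculus)
    show "0 \<le> t" using that by simp
    fix s
    have D: "((\<lambda>s. ?\<gamma> s $ i) has_real_derivative
        (?h s $ 1 *\<^sub>R X1 (?\<gamma> s) + ?h s $ 2 *\<^sub>R X2 (?\<gamma> s)) $ i) (at s within {0..t})" for i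
      using exhaust_4[of i] assms(1-4)
      by (auto simp: X1_def X2_def intro: has_field_derivative_at_within)
    show "(?\<gamma> has_vector_derivative (?h s $ 1 *\<^sub>R X1 (?\<gamma> s) + ?h s $ 2 *\<^sub>R X2 (?\<gamma> s)))
        (at s within {0..t})"
      unfolding has_vector_derivative_def
    proof (rule has_derivative_componentwise_within[THEN iffD2], rule ballI)
      fix b :: "real^4" assume "b \<in> Basis"
      then obtain i where b: "b = axis i 1" by (auto simp: Basis_vec_def)
      show "((\<lambda>t. ?\<gamma> t \<bullet> b) has_derivative
          (\<lambda>x. (x *\<^sub>R (?h s $ 1 *\<^sub>R X1 (?\<gamma> s) + ?h s $ 2 *\<^sub>R X2 (?\<gamma> s))) \<bullet> b)) (at s within {0..t})"
        unfolding b inner_axis inner_real_def vector_scaleR_component real_scaleR_def mult_1_right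
        using D[of i, unfolded has_field_derivative_def] by (simp only: mult_commute_abs)
    qed
  qed
  ultimately show ?thesis unfolding horizontal_curve_def by blast
qed

lemma vec4_eqI:
  fixes p q :: "real^4"
  assumes "p $ 1 = q $ 1" "p $ 2 = q $ 2" "p $ 3 = q $ 3" "p $ 4 = q $ 4"
  shows "p = q"
  using assms by (simp add: vec_eq_iff forall_4)

text \<open>
  Once the first coordinate \<open>p\<close> of the curve is chosen, the other endpoint conditions prescribe the
  integrals of \<open>v\<close>, \<open>v p\<close> and \<open>v p\<^sup>2\<close>, where \<open>v\<close> is the speed along \<open>X2\<close>. We take \<open>p = w\<^sub>1 t\<close> with \<open>v\<close> a
  combination of shifted Legendre polynomials, or \<open>p = t - t\<^sup>2\<close> when \<open>w\<^sub>1 = 0\<close>; the first four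
  moments of the latter are 1/6, 1/30, 1/140, 1/630.
\<close>

lemma horizontal_curve_to_W:
  assumes "w \<in> W"
  obtains h \<gamma> where "horizontal_curve h \<gamma>" "\<gamma> 0 = 0" "\<gamma> 1 = w"
proof (cases "w $ 1 = 0")
  case True
  \<comment> \<open>The matrix is the Gram matrix of \<open>p - 1/6\<close> and
    \<open>p^2 - 1/30\<close>, the powers of \<open>p\<close> minus their means over the unit
    interval; it is invertible. Subtracting the means makes the second coordinate return to
    0.\<close>
  obtain \<alpha> \<beta> :: real where \<alpha>\<beta>: "\<alpha> / 180 + \<beta> / 630 = w $ 3" "\<alpha> / 630 + \<beta> / 2100 = 2 * w $ 4"
  proof
    show "(3780 * w $ 3 - 25200 * w $ 4) / 180 + (88200 * w $ 4 - 12600 * w $ 3) / 630 = w $ 3"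
      "(3780 * w $ 3 - 25200 * w $ 4) / 630 + (88200 * w $ 4 - 12600 * w $ 3) / 2100 = 2 * w $ 4"
      by (simp_all add: field_simps)
  qed
  define p :: "real \<Rightarrow> real" where "p t = t - t^2" for t
  \<comment> \<open>\<open>I1\<close> to \<open>I4\<close> are the primitives of \<open>p\<close>,
    ..., \<open>p^4\<close> that vanish at 0; their values at 1 are the moments.\<close>
  define I1 :: "real \<Rightarrow> real" where "I1 t = t^2/2 - t^3/3" for t
  define I2 :: "real \<Rightarrow> real" where "I2 t = t^3/3 - t^4/2 + t^5/5" for t
  define I3 :: "real \<Rightarrow> real" where "I3 t = t^4/4 - 3*t^5/5 + t^6/2 - t^7/7" for t
  define I4 :: "real \<Rightarrow> real" where "I4 t = t^5/5 - 2*t^6/3 + 6*t^7/7 - t^8/2 + t^9/9" for t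
  note I_def = I1_def I2_def I3_def I4_def
  have "(I1 has_real_derivative p t) (at t)" "(I2 has_real_derivative (p t)^2) (at t)"
    "(I3 has_real_derivative (p t)^3) (at t)" "(I4 has_real_derivative (p t)^4) (at t)" for t
    unfolding I_def p_def
    by (auto intro!: derivative_eq_intros simp: algebra_simps eval_nat_numeral)
  note D = this
  define v where "v t = \<alpha> * (p t - 1/6) + \<beta> * ((p t)^2 - 1/30)" for t
  show ?thesis
  proof (rule that[OF horizontal_curveI])
    show "(p has_real_derivative 1 - 2 * t) (at t)" for t
      unfolding p_def by (auto intro!: derivative_eq_intros)
    show "((\<lambda>t. \<alpha> * (I1 t - t/6) + \<beta> * (I2 t - t/30)) has_real_derivative v t) (at t)" for t
      unfolding v_def by (auto intro!: derivative_eq_intros D)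
    show "((\<lambda>t. \<alpha> * (I2 t - I1 t/6) + \<beta> * (I3 t - I1 t/30)) has_real_derivative v t * p t) (at t)" for t
      unfolding v_def by (auto intro!: derivative_eq_intros D simp: algebra_simps power2_eq_square power3_eq_cube)
    show "((\<lambda>t. (\<alpha> * (I3 t - I2 t/6) + \<beta> * (I4 t - I2 t/30)) / 2)
        has_real_derivative v t * ((p t)^2 / 2)) (at t)" for t
      unfolding v_def
      by (auto intro!: derivative_eq_intros D simp: algebra_simps power2_eq_square power3_eq_cube power4_eq_xxxx add_divide_distrib diff_divide_distrib)
    show "continuous_on UNIV (\<lambda>t::real. 1 - 2 * t)" "continuous_on UNIV v"
      unfolding v_def p_def by (intro continuous_intros)+
    show "vector [p 0, \<alpha> * (I1 0 - 0/6) + \<beta> * (I2 0 - 0/30), \<alpha> * (I2 0 - I1 0/6) + \<beta> * (I3 0 - I1 0/30),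
        (\<alpha> * (I3 0 - I2 0/6) + \<beta> * (I4 0 - I2 0/30)) / 2] = (0 :: real^4)"
      by (rule vec4_eqI) (simp_all add: p_def I_def)
    show "vector [p 1, \<alpha> * (I1 1 - 1/6) + \<beta> * (I2 1 - 1/30), \<alpha> * (I2 1 - I1 1/6) + \<beta> * (I3 1 - I1 1/30),
        (\<alpha> * (I3 1 - I2 1/6) + \<beta> * (I4 1 - I2 1/30)) / 2] = w"
      using True assms \<alpha>\<beta> by (intro vec4_eqI) (simp_all add: p_def I_def W_def)
  qed
next
  case False
  define k where "k = w $ 1"
  \<comment> \<open>For \<open>v\<close> below, the integrals of \<open>v\<close>,
    \<open>v t\<close> and \<open>v t^2\<close> over the unit interval are 0,
    \<open>\<alpha> / 6\<close> and \<open>\<alpha> / 6 + \<beta> / 30\<close>; the system is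
    triangular.\<close>
  define \<alpha> \<beta> where "\<alpha> = 6 * w $ 3 / k" and "\<beta> = 60 * w $ 4 / k\<^sup>2 - 5 * \<alpha>"
  have "\<alpha> / 6 + \<beta> / 30 = 2 * w $ 4 / k\<^sup>2" by (simp add: k_def \<beta>_def diff_divide_distrib)
  then have \<alpha>\<beta>: "k * (\<alpha> / 6) = w $ 3" "k\<^sup>2 / 2 * (\<alpha> / 6 + \<beta> / 30) = w $ 4"
    using False by (simp_all add: k_def \<alpha>_def)
  define v where "v t = \<alpha> * (2 * t - 1) + \<beta> * (6 * t^2 - 6 * t + 1)" for t
  define x2 where "x2 t = \<alpha> * (t^2 - t) + \<beta> * (2 * t^3 - 3 * t^2 + t)" for t
  define x3 where "x3 t = k * (\<alpha> * (2 * t^3/3 - t^2/2) + \<beta> * (3 * t^4/2 - 2 * t^3 + t^2/2))" for t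
  define x4 where "x4 t = k\<^sup>2 / 2 * (\<alpha> * (t^4/2 - t^3/3) + \<beta> * (6 * t^5/5 - 3 * t^4/2 + t^3/3))" for t
  show ?thesis
  proof (rule that[OF horizontal_curveI])
    show "((\<lambda>t. k * t) has_real_derivative k) (at t)" for t
      by (auto intro!: derivative_eq_intros)
    show "(x2 has_real_derivative v t) (at t)" for t
      unfolding v_def x2_def by (auto intro!: derivative_eq_intros)
    show "(x3 has_real_derivative v t * (k * t)) (at t)" for t
      unfolding v_def x3_def
      by (auto intro!: derivative_eq_intros simp: algebra_simps power2_eq_square power3_eq_cube)
    show "(x4 has_real_derivative v t * ((k * t)\<^sup>2 / 2)) (at t)" for t
      unfolding v_def x4_def
      by (auto intro!: derivative_eq_intros simp: algebra_simps eval_nat_numeral add_divide_distrib diff_divide_distrib)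
    show "continuous_on UNIV (\<lambda>t::real. k)" "continuous_on UNIV v"
      unfolding v_def by (intro continuous_intros)+
    show "vector [k * 0, x2 0, x3 0, x4 0] = (0 :: real^4)"
      by (rule vec4_eqI) (simp_all add: x2_def x3_def x4_def)
    show "vector [k * 1, x2 1, x3 1, x4 1] = w"
      using \<alpha>\<beta> assms by (intro vec4_eqI) (simp_all add: x2_def x3_def x4_def W_def k_def)
  qed
qed

section \<open>Comparison of the Carnot-Caratheodory norm with a homogeneous box\<close>

text \<open>The strict inequality with a free radius \<open>r\<close> avoids any appeal to a
  length-minimizing curve: some admissible curve is already shorter than \<open>c * r\<close>, and
  its endpoint bounds apply.\<close>

lemma cc_norm_bound:
  assumes "scalar_product_on_V1 B"
  obtains c where "0 < c" and "\<And>w r. \<lbrakk>w \<in> W; cc_norm B w < c * r\<rbrakk> \<Longrightarrow>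
      0 < r \<and> \<bar>w $ 1\<bar> \<le> r \<and> \<bar>w $ 3\<bar> \<le> r ^ 2 \<and> \<bar>w $ 4\<bar> \<le> r ^ 3"
proof -
  obtain c C where c: "0 < c" "\<And>u. c * norm u \<le> sqrt (B u u)" "\<And>u. sqrt (B u u) \<le> C * norm u"
    "continuous_on UNIV (\<lambda>u. sqrt (B u u))"
    by (rule scalar_product_bounds[OF assms]) (rule that, simp_all)
  show thesis
  proof (rule that[OF c(1)])
    fix w r assume w: "w \<in> W" and less: "cc_norm B w < c * r"
    define S where "S = {curve_length B h | h \<gamma>. horizontal_curve h \<gamma> \<and> \<gamma> 0 = 0 \<and> \<gamma> 1 = w}"
    \<comment> \<open>needed because \<open>Inf\<close> of the empty set of reals is an arbitrary value\<close>
    have "S \<noteq> {}" using horizontal_curve_to_W[OF w] unfolding S_def by blast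
    moreover have "Inf S < c * r" using less by (simp add: cc_norm_def cc_dist_def S_def)
    ultimately obtain h \<gamma> where hc: "horizontal_curve h \<gamma>" "\<gamma> 0 = 0" "\<gamma> 1 = w"
      and l: "curve_length B h < c * r"
      using cInf_lessD[of S "c * r"] unfolding S_def by blast
    define M where "M = integral {0..1} (\<lambda>t. norm (h t))"
    have abs: "h absolutely_integrable_on {0..1}" using hc(1) by (simp add: horizontal_curve_def)
    have "0 \<le> M" unfolding M_def
      using abs by (intro integral_nonneg) (auto simp: absolutely_integrable_on_def)
    moreover have "M < r"
      using norm_integral_le_curve_length[where B = B and c = c and C = C, OF less_imp_le[OF c(1)] c(2,3,4) abs] l c(1)
      by (simp add: M_def) (meson le_less_trans mult_less_cancel_left_pos)
    ultimately have "0 < r" "M ^ 2 \<le> r ^ 2" "M ^ 3 \<le> r ^ 3"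
      by (auto intro: power_mono)
    then show "0 < r \<and> \<bar>w $ 1\<bar> \<le> r \<and> \<bar>w $ 3\<bar> \<le> r ^ 2 \<and> \<bar>w $ 4\<bar> \<le> r ^ 3"
      using horizontal_curve_endpoint_bounds[OF hc(1,2)] \<open>M < r\<close> unfolding hc(3) M_def[symmetric]
      by linarith
  qed
qed

section \<open>The cone of directions that preserve a calibrated set\<close>

text \<open>Moving forward along \<open>X2\<close> at varying first coordinate \<open>u\<close>
  produces the total mass \<open>x $ 2\<close>, the first moment \<open>x $ 3\<close> of
  \<open>u\<close> and half its second moment \<open>x $ 4\<close>. The hypothesis is the strict
  Cauchy-Schwarz inequality for these, and two steps suffice to realize them.\<close>

lemma calibrated_semigroup:
  assumes cal: "X2_calibrated E" and p: "p \<in> E"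
    and x: "0 < x $ 2" "(x $ 3)\<^sup>2 < 2 * x $ 2 * x $ 4"
  shows "p \<odot> x \<in> E"
proof -
  have flow1: "p + vector [t, 0, 0, 0] \<in> E" if "p \<in> E" for p t
    using cal that by (simp add: X2_calibrated_def)
  have flow2: "p + vector [0, t, p$1 * t, (p$1)\<^sup>2 * t / 2] \<in> E" if "p \<in> E" "0 \<le> t" for p t
  proof -
    obtain T :: ereal where T: "{t::real. p + vector [0, t, p$1 * t, (p$1)\<^sup>2 * t / 2] \<in> E} = {t. T < ereal t}"
      using cal unfolding X2_calibrated_def by blast
    have "p + vector [0, 0, p$1 * 0, (p$1)\<^sup>2 * 0 / 2] = p" by (rule vec4_eqI) simp_all
    then have "0 \<in> {t::real. p + vector [0, t, p$1 * t, (p$1)\<^sup>2 * t / 2] \<in> E}" using that(1) by simp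
    then have "T < ereal t" using that(2) unfolding T by (simp add: less_le_trans)
    then show ?thesis using T by blast
  qed
  \<comment> \<open>two equal steps along \<open>X2\<close> at first coordinates \<open>m + k\<close> and \<open>m - k\<close>: their mean and mean square
    are determined by \<open>x\<close>\<close>
  define m where "m = x $ 3 / x $ 2"
  define k where "k = sqrt (2 * x $ 4 / x $ 2 - m\<^sup>2)"
  \<comment> \<open>The cone condition, divided by the square of \<open>x $ 2\<close>, makes the
    radicand positive.\<close>
  have k2: "k\<^sup>2 = 2 * x $ 4 / x $ 2 - m\<^sup>2"
    using x unfolding k_def m_def by (simp add: field_simps power2_eq_square)
  define s where "s = x $ 2 / 2"
  have x2: "x $ 2 = 2 * s" by (simp add: s_def)
  have x3: "x $ 3 = 2 * m * s" using x(1) by (simp add: m_def s_def)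
  have x4: "x $ 4 = s * (m\<^sup>2 + k\<^sup>2)" using x(1) k2 by (simp add: s_def)
  define p1 where "p1 = p + vector [m + k, 0, 0, 0]"
  define p2 where "p2 = p1 + vector [0, s, p1$1 * s, (p1$1)\<^sup>2 * s / 2]"
  define p3 where "p3 = p2 + vector [- 2 * k, 0, 0, 0]"
  define p4 where "p4 = p3 + vector [0, s, p3$1 * s, (p3$1)\<^sup>2 * s / 2]"
  define p5 where "p5 = p4 + vector [x $ 1 - m + k, 0, 0, 0]"
  have s: "0 \<le> s" using x(1) by (simp add: s_def)
  have "p1 \<in> E" unfolding p1_def by (rule flow1[OF p])
  then have "p2 \<in> E" unfolding p2_def by (rule flow2[OF _ s])
  then have "p3 \<in> E" unfolding p3_def by (rule flow1)
  then have "p4 \<in> E" unfolding p4_def by (rule flow2[OF _ s])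
  then have "p5 \<in> E" unfolding p5_def by (rule flow1)
  moreover have "p5 = p \<odot> x"
    unfolding p5_def p4_def p3_def p2_def p1_def engel_mult_def x2 x3 x4
    by (rule vec4_eqI; simp only: vector_add_component vector_4;
        simp add: algebra_simps add_divide_distrib diff_divide_distrib power2_eq_square)
  ultimately show ?thesis by simp
qed

section \<open>Position of the graph relative to the cone\<close>

lemma graph_notin_upper_graph:
  assumes "q \<in> intrinsic_graph a T"
  shows "q \<notin> intrinsic_upper_graph a T"
proof
  assume "q \<in> intrinsic_upper_graph a T"
  then obtain w t where w: "w \<in> W" "T w < t" "q = w \<odot> expY a t"
    unfolding intrinsic_upper_graph_def by blast
  obtain v where v: "v \<in> W" "q = v \<odot> expY a (T v)"
    using assms unfolding intrinsic_graph_def by blast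
  have "(w, t) = (v, T v)"
    using ex1_decomposition[of q a] by (rule ex1E) (metis (mono_tags, lifting) case_prodI w(1,3) v)
  then show False using w(2) by simp
qed

lemma expY_add: "expY a s \<odot> expY a t = expY a (s + t)"
  by (rule vec4_eqI)
    (simp_all add: mult_expY, simp_all add: expY_def field_simps power2_eq_square power3_eq_cube)

lemma graph_mult_expY_in_upper_graph:
  assumes "q \<in> intrinsic_graph a T" "0 < e"
  shows "q \<odot> expY a e \<in> intrinsic_upper_graph a T"
proof -
  interpret group engel_mult 0 engel_inv by (rule engel_group)
  obtain w where "w \<in> W" "q = w \<odot> expY a (T w)"
    using assms(1) by (auto simp: intrinsic_graph_def)
  then show ?thesis
    using assms(2) by (auto simp: intrinsic_upper_graph_def assoc expY_add intro!: exI[of _ "T w + e"])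
qed

text \<open>The semigroup property cannot start at \<open>q\<close>, which lies outside the upper
  graph. It starts instead at \<open>q \<odot> expY a e\<close>, which lies inside; the cone is
  open, so the remaining factor is still in it for small \<open>e\<close>, and \<open>q'\<close>
  would lie in the upper graph.\<close>

lemma graph_avoids_cone:
  assumes cal: "X2_calibrated (intrinsic_upper_graph a T)"
    and q: "q \<in> intrinsic_graph a T" "q' \<in> intrinsic_graph a T"
    and z: "engel_inv q \<odot> q' = z" "0 < z $ 2"
  shows "2 * z $ 2 * z $ 4 \<le> (z $ 3)\<^sup>2"
proof (rule ccontr)
  interpret group engel_mult 0 engel_inv by (rule engel_group)
  assume "\<not> ?thesis"
  then have less: "0 < 2 * z $ 2 * z $ 4 - (z $ 3)\<^sup>2" by simp
  let ?y = "\<lambda>e. expY a (- e) \<odot> z"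
  let ?Q = "\<lambda>e. 2 * ?y e $ 2 * ?y e $ 4 - (?y e $ 3)\<^sup>2"
  have "?y 0 = z" by (rule vec4_eqI) (simp_all add: engel_mult_def expY_def)
  moreover have "isCont ?Q 0" "isCont (\<lambda>e. ?y e $ 2) 0"
    unfolding engel_mult_def expY_def vector_4 by (intro continuous_intros; simp)+
  ultimately have "(?Q \<longlongrightarrow> 2 * z $ 2 * z $ 4 - (z $ 3)\<^sup>2) (at_right 0)"
    "((\<lambda>e. ?y e $ 2) \<longlongrightarrow> z $ 2) (at_right 0)"
    unfolding isCont_def by (auto intro: filterlim_mono at_le)
  then have "\<forall>\<^sub>F e in at_right 0. 0 < ?Q e \<and> 0 < ?y e $ 2 \<and> 0 < e"
    using less z(2) by (intro eventually_conj order_tendstoD(1) eventually_at_right_less)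
  then obtain e where e: "0 < ?Q e" "0 < ?y e $ 2" "0 < e"
    using eventually_happens'[OF trivial_limit_at_right_real] by blast
  have "(q \<odot> expY a e) \<odot> ?y e \<in> intrinsic_upper_graph a T"
    by (rule calibrated_semigroup[OF cal graph_mult_expY_in_upper_graph[OF q(1) e(3)] e(2)])
      (use e(1) in simp)
  also have "(q \<odot> expY a e) \<odot> ?y e = q \<odot> (expY a e \<odot> expY a (- e)) \<odot> z" by (simp only: assoc)
  also have "expY a e \<odot> expY a (- e) = 0"
    unfolding expY_add by (rule vec4_eqI) (simp_all add: expY_def)
  also have "q \<odot> 0 \<odot> z = q'" by (simp add: z(1)[symmetric] assoc[symmetric])
  finally show False using graph_notin_upper_graph[OF q(2)] by simp
qed

section \<open>The Lipschitz estimate\<close>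

theorem theorem4p5:
  fixes E :: "(real^4) set" and a :: real and T :: "real^4 \<Rightarrow> real"
    and B :: "real^2 \<Rightarrow> real^2 \<Rightarrow> real"
  assumes "scalar_product_on_V1 B"
    and "X2_calibrated E"
    and "a \<noteq> 0"
    and "E = intrinsic_upper_graph a T"
  shows "intrinsic_Lipschitz B a T"
proof -
  interpret group engel_mult 0 engel_inv by (rule engel_group)
  have cal: "X2_calibrated (intrinsic_upper_graph a T)" using assms(2,4) by simp
  obtain c where c: "0 < c" and bound: "\<And>w r. \<lbrakk>w \<in> W; cc_norm B w < c * r\<rbrakk> \<Longrightarrow>
      0 < r \<and> \<bar>w $ 1\<bar> \<le> r \<and> \<bar>w $ 3\<bar> \<le> r ^ 2 \<and> \<bar>w $ 4\<bar> \<le> r ^ 3"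
    by (rule cc_norm_bound[OF assms(1)]) (rule that; blast)
  \<comment> \<open>The error terms below add up to at most
    \<open>\<delta> * (5 + \<bar>a\<bar>) * s ^ 4\<close>, against a main term
    \<open>a\<^sup>2 * s ^ 4 / 12\<close>; 6 in place of 5 makes the comparison strict. Since
    \<delta> is at most 1, its higher powers can be replaced by \<delta>.\<close>
  define \<delta> where "\<delta> = min 1 (a\<^sup>2 / (12 * (6 + \<bar>a\<bar>)))"
  have \<delta>: "0 < \<delta>" "\<delta> \<le> 1" "\<delta> * (6 + \<bar>a\<bar>) \<le> a\<^sup>2 / 12"
  proof -
    show "0 < \<delta>" "\<delta> \<le> 1" using assms(3) by (auto simp: \<delta>_def)
    have "\<delta> * (6 + \<bar>a\<bar>) \<le> a\<^sup>2 / (12 * (6 + \<bar>a\<bar>)) * (6 + \<bar>a\<bar>)"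
      by (intro mult_right_mono) (auto simp: \<delta>_def)
    also have "\<dots> = a\<^sup>2 / 12" by (simp add: field_simps)
    finally show "\<delta> * (6 + \<bar>a\<bar>) \<le> a\<^sup>2 / 12" .
  qed
  show ?thesis
    unfolding intrinsic_Lipschitz_def
  proof (intro exI conjI ballI allI impI)
    show "0 \<le> 1 / (c * \<delta>)" using c \<delta> by simp
    fix q q' w s
    assume q: "q \<in> intrinsic_graph a T" "q' \<in> intrinsic_graph a T"
      and w: "w \<in> W" and eq: "engel_inv q \<odot> q' = w \<odot> expY a s"
    show "\<bar>s\<bar> \<le> 1 / (c * \<delta>) * cc_norm B w"
    proof (rule ccontr)
      assume "\<not> ?thesis"
      then have "cc_norm B w < c * (\<delta> * \<bar>s\<bar>)" using c \<delta>(1) by (simp add: field_simps)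
      from bound[OF w this] have s: "0 < \<delta> * \<bar>s\<bar>" and w1: "\<bar>w $ 1\<bar> \<le> \<delta> * \<bar>s\<bar>"
        and w3: "\<bar>w $ 3\<bar> \<le> (\<delta> * \<bar>s\<bar>)\<^sup>2" and w4: "\<bar>w $ 4\<bar> \<le> (\<delta> * \<bar>s\<bar>) ^ 3" by auto
      have s0: "s \<noteq> 0" using s by auto
      define z where "z = w \<odot> expY a s"
      have w2: "w $ 2 = 0" using w by (simp add: W_def)
      \<comment> \<open>The first term is the value at \<open>expY a s\<close>, positive because
        \<open>a \<noteq> 0\<close>. Terms containing only \<open>w $ 1\<close> cancel, and every
        other term has degree 4 under the dilations, hence is small relative to
        \<open>s ^ 4\<close>.\<close>
      have Q: "2 * z $ 2 * z $ 4 - (z $ 3)\<^sup>2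
          = a\<^sup>2 * s ^ 4 / 12 + 2 * s * w $ 4 - (w $ 3)\<^sup>2 - 2 * w $ 1 * w $ 3 * s - a * w $ 3 * s\<^sup>2"
        unfolding z_def mult_expY vector_4 w2
        by (simp add: field_simps power2_eq_square power3_eq_cube power4_eq_xxxx)
      have pw: "\<delta> ^ n * S \<le> \<delta> * S" if "0 \<le> S" "1 \<le> n" for n S
        using \<delta>(1,2) that by (intro mult_right_mono) (auto intro: power_decreasing[of 1 n \<delta>, simplified])
      have t4: "\<bar>2 * s * w $ 4\<bar> \<le> 2 * \<delta> * s ^ 4"
      proof -
        have "\<bar>s\<bar> * \<bar>w $ 4\<bar> \<le> \<bar>s\<bar> * (\<delta> * \<bar>s\<bar>) ^ 3" by (intro mult_left_mono w4) auto
        also have "\<dots> = \<delta> ^ 3 * s ^ 4"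
          by (simp add: power_mult_distrib power3_eq_cube power4_eq_xxxx)
        also have "\<dots> \<le> \<delta> * s ^ 4" by (rule pw) auto
        finally show ?thesis by (simp add: abs_mult)
      qed
      have t33: "(w $ 3)\<^sup>2 \<le> \<delta> * s ^ 4"
      proof -
        have "\<bar>w $ 3\<bar>\<^sup>2 \<le> ((\<delta> * \<bar>s\<bar>)\<^sup>2)\<^sup>2" by (intro power_mono w3) auto
        also have "\<dots> = \<delta> ^ 4 * s ^ 4" by (simp add: power_mult_distrib flip: power_mult)
        also have "\<dots> \<le> \<delta> * s ^ 4" by (rule pw) auto
        finally show ?thesis by simp
      qed
      have t13: "\<bar>2 * w $ 1 * w $ 3 * s\<bar> \<le> 2 * \<delta> * s ^ 4"
      proof -
        have "\<bar>w $ 1\<bar> * \<bar>w $ 3\<bar> * \<bar>s\<bar> \<le> (\<delta> * \<bar>s\<bar>) * (\<delta> * \<bar>s\<bar>)\<^sup>2 * \<bar>s\<bar>"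
          using s by (intro mult_right_mono mult_mono w1 w3) auto
        also have "\<dots> = \<delta> ^ 3 * s ^ 4"
          by (simp add: power_mult_distrib power3_eq_cube power2_eq_square power4_eq_xxxx)
        also have "\<dots> \<le> \<delta> * s ^ 4" by (rule pw) auto
        finally show ?thesis by (simp add: abs_mult)
      qed
      have t3: "\<bar>a * w $ 3 * s\<^sup>2\<bar> \<le> \<delta> * \<bar>a\<bar> * s ^ 4"
      proof -
        have "\<bar>a\<bar> * \<bar>w $ 3\<bar> * s\<^sup>2 \<le> \<bar>a\<bar> * (\<delta> * \<bar>s\<bar>)\<^sup>2 * s\<^sup>2"
          by (intro mult_right_mono mult_left_mono w3) auto
        also have "\<dots> = \<delta> ^ 2 * (\<bar>a\<bar> * s ^ 4)"
          by (simp add: power_mult_distrib power2_eq_square power4_eq_xxxx)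
        also have "\<dots> \<le> \<delta> * (\<bar>a\<bar> * s ^ 4)" by (rule pw) auto
        finally show ?thesis by (simp add: abs_mult mult.assoc)
      qed
      have "0 < \<delta> * s ^ 4" using \<delta>(1) s0 by simp
      moreover have "\<delta> * (6 + \<bar>a\<bar>) * s ^ 4 \<le> a\<^sup>2 / 12 * s ^ 4"
        by (intro mult_right_mono \<delta>(3)) auto
      then have "6 * (\<delta> * s ^ 4) + \<delta> * \<bar>a\<bar> * s ^ 4 \<le> a\<^sup>2 * s ^ 4 / 12" by (simp add: algebra_simps)
      ultimately have pos: "(z $ 3)\<^sup>2 < 2 * z $ 2 * z $ 4"
        using Q t4 t33 t13 t3 by linarith
      have z2: "z $ 2 = s" by (simp add: z_def mult_expY w2)
      show False
      proof (cases "0 < s")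
        case True
        then show False using graph_avoids_cone[OF cal q] eq z_def z2 pos by force
      next
        case False
        \<comment> \<open>For negative \<open>s\<close> the roles of \<open>q\<close> and
          \<open>q'\<close> are exchanged: inversion flips the sign of the second coordinate and
          preserves \<open>2 * z $ 2 * z $ 4 - (z $ 3)\<^sup>2\<close>.\<close>
        define y where "y = engel_inv q' \<odot> q"
        have y: "y = engel_inv z"
          unfolding z_def eq[symmetric] y_def by (simp add: inverse_distrib_swap)
        have "2 * y $ 2 * y $ 4 - (y $ 3)\<^sup>2 = 2 * z $ 2 * z $ 4 - (z $ 3)\<^sup>2"
          unfolding y engel_inv_def vector_4 by (simp add: field_simps power2_eq_square)
        moreover have "0 < y $ 2" using False s0 z2 by (simp add: y engel_inv_def)
        ultimately show False using graph_avoids_cone[OF cal q(2,1) y_def[symmetric]] pos by simp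
      qed
    qed
  qed
qed

end
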